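(* Let $n\ge 2$, let $G=[g_{ij}]$ be an interaction network on $N=\{1,\dots,n\}$, let $\tau_x,\tau_y>0$, let $\gamma=\tau_x/(\tau_x+\tau_y)$, and let $i\in N$. Then $\Delta U_i(\tau_x,\tau_y,G)<0$ if and only if $$c_i^2(\gamma,G)<\sum_{j\ne i}g_{ij}\,c_j(\gamma,G)\big(c_j(\gamma,G)-2\big).$$
   Context: Interaction network: an $n\times n$ real matrix $G=[g_{ij}]$ with $g_{ij}\ge 0$, $g_{ii}=0$, and $d_i^{out}:=\sum_{j\ne i}g_{ij}<1$ for all $i\in N$. Payoffs: agent $i$ chooses $a_i\in\mathbb{R}$; with $a=(a_j)_{j\in N}$ and common state $\theta\in\mathbb{R}$, $$u_i(a,\theta)=-\Big(1-\sum_{j\neq i}g_{ij}\Big)(a_i-\theta)^2-\sum_{j\ne i}g_{ij}(a_i-a_j)^2 .$$ Information: $\theta$ has the improper uniform prior on $\mathbb{R}$. Agent $i$ observes a private signal $x_i=\theta+\varepsilon_i$ and a public signal $y=\theta+\varepsilon_y$, where $\varepsilon_i\sim N(0,\tau_x^{-1})$, $\varepsilon_y\sim N(0,\tau_y^{-1})$, and $\theta,\varepsilon_1,\dots,\varepsilon_n,\varepsilon_y$ are jointly independent. $\gamma=\tau_x/(\tau_x+\tau_y)\in(0,1)$. Katz-Bonacich centrality vector: $\mathbf{c}(\gamma,G)=(c_1(\gamma,G),\dots,c_n(\gamma,G))'=(I-\gamma G)^{-1}\mathbf{1}$, where $\mathbf{1}$ is the all-ones vector. Equilibrium: the game has a unique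 linear Bayesian Nash equilibrium, $a_i^*=(1-\gamma)c_i(\gamma,G)\,y+\big(1-(1-\gamma)c_i(\gamma,G)\big)x_i$ for $i\in N$. Equilibrium payoff: $U_i(\tau_x,\tau_y,G)=\mathbb{E}[u_i(a^*,\theta)]$, where the expectation is over the noise terms (the payoff $u_i(a^*,\theta)$ depends only on the noise terms, not on $\theta$). $U_i(\tau_x,0,G)=-\tau_x^{-1}(1+d_i^{out})$ denotes agent $i$'s equilibrium payoff in the absence of the public signal (where $a_i=x_i$ for all $i$). The effect of public information provision on agent $i$ is $\Delta U_i(\tau_x,\tau_y,G)=U_i(\tau_x,\tau_y,G)-U_i(\tau_x,0,G)$. *)

theory Defs
  imports "HOL-Probability.Probability"
begin

text \<open>Agents are the elements of the finite type \<open>'n\<close>.\<close>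

definition out_degree :: "real ^ 'n ^ 'n \<Rightarrow> 'n::finite \<Rightarrow> real" where
  "out_degree G i = (\<Sum>j\<in>UNIV - {i}. G $ i $ j)"

definition interaction_network :: "real ^ 'n ^ 'n \<Rightarrow> bool" where
  "interaction_network G \<longleftrightarrow>
     (\<forall>i j. 0 \<le> G $ i $ j) \<and> (\<forall>i. G $ i $ i = 0) \<and> (\<forall>i. out_degree G i < 1)"

definition payoff :: "real ^ 'n ^ 'n \<Rightarrow> 'n::finite \<Rightarrow> ('n \<Rightarrow> real) \<Rightarrow> real \<Rightarrow> real" where
  "payoff G i a \<theta> =
     - (1 - (\<Sum>j\<in>UNIV - {i}. G $ i $ j)) * (a i - \<theta>)\<^sup>2
     - (\<Sum>j\<in>UNIV - {i}. G $ i $ j * (a i - a j)\<^sup>2)"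

definition katz_bonacich :: "real \<Rightarrow> real ^ 'n ^ 'n \<Rightarrow> real ^ 'n::finite" where
  "katz_bonacich \<gamma> G = matrix_inv (mat 1 - \<gamma> *\<^sub>R G) *v (\<chi> i. 1)"

definition gaussian :: "real \<Rightarrow> real measure" where
  "gaussian \<tau> = density lborel (\<lambda>z. ennreal (normal_density 0 (1 / sqrt \<tau>) z))"

definition private_noise :: "real \<Rightarrow> ('n::finite \<Rightarrow> real) measure" where
  "private_noise \<tau>x = (\<Pi>\<^sub>M j\<in>UNIV. gaussian \<tau>x)"

text \<open>Bayes' rule for the improper uniform prior: the posterior density of the state is
  the likelihood \<open>L\<close> of the observed signals, normalised to total mass one.\<close>

definition posterior :: "(real \<Rightarrow> real) \<Rightarrow> real measure" where
  "posterior L = density lborel (\<lambda>\<theta>. ennreal (L \<theta> / (\<integral>\<theta>'. L \<theta>' \<partial>lborel)))"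

definition private_likelihood :: "real \<Rightarrow> real \<Rightarrow> real \<Rightarrow> real" where
  "private_likelihood \<tau>x x \<theta> = normal_density \<theta> (1 / sqrt \<tau>x) x"

definition joint_likelihood :: "real \<Rightarrow> real \<Rightarrow> real \<Rightarrow> real \<Rightarrow> real \<Rightarrow> real" where
  "joint_likelihood \<tau>x \<tau>y x y \<theta> =
     normal_density \<theta> (1 / sqrt \<tau>x) x * normal_density \<theta> (1 / sqrt \<tau>y) y"

text \<open>Conditional expectation of \<open>i\<close>'s payoff from the action \<open>t\<close>, given signals with
  likelihood \<open>L\<close>, when each opponent \<open>j\<close> plays \<open>s j\<close> as a function of her private signal
  (a public signal, being known to \<open>i\<close>, is already substituted in \<open>s\<close>). Given the state,
  the noise of the opponents is independent of what \<open>i\<close> observes, so it keeps its prior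
  law; the coordinate \<open>\<epsilon> i\<close> is not used.\<close>

definition interim_payoff ::
  "real \<Rightarrow> real ^ 'n ^ 'n \<Rightarrow> (real \<Rightarrow> real) \<Rightarrow> 'n::finite \<Rightarrow> ('n \<Rightarrow> real \<Rightarrow> real) \<Rightarrow> real \<Rightarrow> real"
where
  "interim_payoff \<tau>x G L i s t =
     (\<integral>\<theta>. (\<integral>\<epsilon>. payoff G i (\<lambda>j. if j = i then t else s j (\<theta> + \<epsilon> j)) \<theta> \<partial>private_noise \<tau>x)
        \<partial>posterior L)"

text \<open>With the public signal, \<open>\<sigma> j x y\<close> is the action of \<open>j\<close> at private signal \<open>x\<close> and public
  signal \<open>y\<close>; deviations are to arbitrary actions at every signal realisation. Linear
  strategies are allowed an intercept, so that uniqueness is within this larger class.\<close>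

definition linear_BNE ::
  "real \<Rightarrow> real \<Rightarrow> real ^ 'n ^ 'n \<Rightarrow> ('n::finite \<Rightarrow> real \<Rightarrow> real \<Rightarrow> real) \<Rightarrow> bool"
where
  "linear_BNE \<tau>x \<tau>y G \<sigma> \<longleftrightarrow>
     (\<forall>i. \<exists>\<alpha> \<beta> \<kappa>. \<forall>x y. \<sigma> i x y = \<alpha> * y + \<beta> * x + \<kappa>) \<and>
     (\<forall>i x y t.
        interim_payoff \<tau>x G (joint_likelihood \<tau>x \<tau>y x y) i (\<lambda>j x'. \<sigma> j x' y) t
        \<le> interim_payoff \<tau>x G (joint_likelihood \<tau>x \<tau>y x y) i (\<lambda>j x'. \<sigma> j x' y) (\<sigma> i x y))"

definition linear_BNE_private ::
  "real \<Rightarrow> real ^ 'n ^ 'n \<Rightarrow> ('n::finite \<Rightarrow> real \<Rightarrow> real) \<Rightarrow> bool"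
where
  "linear_BNE_private \<tau>x G \<sigma> \<longleftrightarrow>
     (\<forall>i. \<exists>\<beta> \<kappa>. \<forall>x. \<sigma> i x = \<beta> * x + \<kappa>) \<and>
     (\<forall>i x t.
        interim_payoff \<tau>x G (private_likelihood \<tau>x x) i \<sigma> t
        \<le> interim_payoff \<tau>x G (private_likelihood \<tau>x x) i \<sigma> (\<sigma> i x))"

definition equilibrium ::
  "real \<Rightarrow> real \<Rightarrow> real ^ 'n ^ 'n \<Rightarrow> 'n::finite \<Rightarrow> real \<Rightarrow> real \<Rightarrow> real" where
  "equilibrium \<tau>x \<tau>y G = (THE \<sigma>. linear_BNE \<tau>x \<tau>y G \<sigma>)"

definition equilibrium_private ::
  "real \<Rightarrow> real ^ 'n ^ 'n \<Rightarrow> 'n::finite \<Rightarrow> real \<Rightarrow> real" where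
  "equilibrium_private \<tau>x G = (THE \<sigma>. linear_BNE_private \<tau>x G \<sigma>)"

text \<open>Under an improper prior the expectation is over the noise only, at a fixed state \<open>\<theta>\<close>.
  At equilibrium it does not depend on \<open>\<theta>\<close>; no particular value is singled out here.\<close>

definition equilibrium_payoff ::
  "real \<Rightarrow> real \<Rightarrow> real ^ 'n ^ 'n \<Rightarrow> real \<Rightarrow> 'n::finite \<Rightarrow> real" where
  "equilibrium_payoff \<tau>x \<tau>y G \<theta> i =
     (\<integral>(\<epsilon>, \<epsilon>y). payoff G i (\<lambda>j. equilibrium \<tau>x \<tau>y G j (\<theta> + \<epsilon> j) (\<theta> + \<epsilon>y)) \<theta>
        \<partial>(private_noise \<tau>x \<Otimes>\<^sub>M gaussian \<tau>y))"

text \<open>The payoff without public signal is a separate definition rather than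
  \<open>equilibrium_payoff\<close> at \<open>\<tau>y = 0\<close>, where \<open>gaussian\<close> degenerates to the null measure.\<close>

definition equilibrium_payoff_private ::
  "real \<Rightarrow> real ^ 'n ^ 'n \<Rightarrow> real \<Rightarrow> 'n::finite \<Rightarrow> real" where
  "equilibrium_payoff_private \<tau>x G \<theta> i =
     (\<integral>\<epsilon>. payoff G i (\<lambda>j. equilibrium_private \<tau>x G j (\<theta> + \<epsilon> j)) \<theta> \<partial>private_noise \<tau>x)"

definition public_info_effect ::
  "real \<Rightarrow> real \<Rightarrow> real ^ 'n ^ 'n \<Rightarrow> real \<Rightarrow> 'n::finite \<Rightarrow> real" where
  "public_info_effect \<tau>x \<tau>y G \<theta> i =
     equilibrium_payoff \<tau>x \<tau>y G \<theta> i - equilibrium_payoff_private \<tau>x G \<theta> i"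

end

theory Submission
  imports Defs
begin

text \<open>
  Against affine opponents the interim payoff is a constant minus \<open>(t - b)\<^sup>2\<close>, where \<open>b\<close> is the
  weighted average of the posterior mean \<open>\<gamma> x + (1 - \<gamma>) y\<close> and the expected opponents' actions.
  Comparing coefficients turns the equilibrium condition into fixed-point equations of \<open>G\<close> and
  \<open>\<gamma> G\<close>, uniquely solvable because row sums are below one; the weight on the public
  signal is \<open>(1 - \<gamma>) c\<close>. The ex-ante payoffs are then quadratic in uncorrelated noise terms. Finally
  \<open>c\<^sub>i = 1 + \<gamma> \<Sum>\<^sub>j g\<^sub>i\<^sub>j c\<^sub>j\<close> removes the cross terms \<open>c\<^sub>i c\<^sub>j\<close>, and the effect becomes
  \<open>(1 - \<gamma>) / \<tau>\<^sub>x\<close> times the difference \<open>c\<^sub>i\<^sup>2 - \<Sum>\<^sub>j g\<^sub>i\<^sub>j c\<^sub>j (c\<^sub>j - 2)\<close>.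
\<close>

section \<open>Moments of the noise\<close>

abbreviation normal_law :: "real \<Rightarrow> real \<Rightarrow> real measure" where
  "normal_law \<mu> s \<equiv> density lborel (normal_density \<mu> s)"

lemma gaussian_eq_normal_law: "gaussian \<tau> = normal_law 0 (1 / sqrt \<tau>)"
  by (simp add: gaussian_def)

lemma normal_law_moments:
  assumes "0 < s"
  shows "has_bochner_integral (normal_law \<mu> s) (\<lambda>z. z - \<mu>) 0"
    and "has_bochner_integral (normal_law \<mu> s) (\<lambda>z. (z - \<mu>)\<^sup>2) (s\<^sup>2)"
proof -
  show "has_bochner_integral (normal_law \<mu> s) (\<lambda>z. z - \<mu>) 0"
    \<comment> \<open>Odd moments are indexed by \<open>k\<close> with exponent
      \<open>2 * k + 1\<close>, so \<open>k = 0\<close> is the mean; below, \<open>k = 1\<close> in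
      the even family is the variance.\<close>
    using normal_moment_odd[OF assms, of \<mu> 0]
    by (intro has_bochner_integral_density) (auto simp: normal_density_nonneg)
  show "has_bochner_integral (normal_law \<mu> s) (\<lambda>z. (z - \<mu>)\<^sup>2) (s\<^sup>2)"
    using normal_moment_even[OF assms, of \<mu> 1]
    by (intro has_bochner_integral_density) (auto simp: normal_density_nonneg)
qed

text \<open>Expanding the square, the cross products integrate to zero. Three variables suffice for
  every payoff term: public noise, own noise and the noise of one opponent.\<close>

lemma has_bochner_integral_square_lincomb3:
  fixes X Y Z :: "'a \<Rightarrow> real"
  assumes "has_bochner_integral M (\<lambda>\<omega>. (X \<omega>)\<^sup>2) u"
    and "has_bochner_integral M (\<lambda>\<omega>. (Y \<omega>)\<^sup>2) v"
    and "has_bochner_integral M (\<lambda>\<omega>. (Z \<omega>)\<^sup>2) w"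
    and "has_bochner_integral M (\<lambda>\<omega>. X \<omega> * Y \<omega>) 0"
    and "has_bochner_integral M (\<lambda>\<omega>. X \<omega> * Z \<omega>) 0"
    and "has_bochner_integral M (\<lambda>\<omega>. Y \<omega> * Z \<omega>) 0"
  shows "has_bochner_integral M (\<lambda>\<omega>. (a * X \<omega> + b * Y \<omega> + c * Z \<omega>)\<^sup>2)
    (a\<^sup>2 * u + b\<^sup>2 * v + c\<^sup>2 * w)"
proof -
  have "has_bochner_integral M
      (\<lambda>\<omega>. a\<^sup>2 * (X \<omega>)\<^sup>2 + b\<^sup>2 * (Y \<omega>)\<^sup>2 + c\<^sup>2 * (Z \<omega>)\<^sup>2
        + (2 * a * b) * (X \<omega> * Y \<omega>) + (2 * a * c) * (X \<omega> * Z \<omega>) + (2 * b * c) * (Y \<omega> * Z \<omega>))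
      (a\<^sup>2 * u + b\<^sup>2 * v + c\<^sup>2 * w + (2 * a * b) * 0 + (2 * a * c) * 0 + (2 * b * c) * 0)"
    by (intro has_bochner_integral_add has_bochner_integral_mult_right assms)
  then show ?thesis
    by (simp add: power2_eq_square algebra_simps)
qed

text \<open>The constant 1 serves as a variable with second moment 1; it is uncorrelated with
  \<open>Y\<close> because \<open>Y\<close> has mean zero. The third variable is set to 0.\<close>

lemma has_bochner_integral_square_affine:
  fixes Y :: "'a \<Rightarrow> real"
  assumes "prob_space M"
    and "has_bochner_integral M Y 0" and "has_bochner_integral M (\<lambda>\<omega>. (Y \<omega>)\<^sup>2) v"
  shows "has_bochner_integral M (\<lambda>\<omega>. (p + q * Y \<omega>)\<^sup>2) (p\<^sup>2 + q\<^sup>2 * v)"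
proof -
  interpret prob_space M by fact
  have "has_bochner_integral M (\<lambda>_. 1::real) 1"
    by (simp add: has_bochner_integral_iff prob_space)
  then show ?thesis
    using has_bochner_integral_square_lincomb3[of M "\<lambda>_. 1" 1 Y v "\<lambda>_. 0" 0 p q 0] assms
    by (simp add: has_bochner_integral_zero)
qed

lemma normal_law_square_affine:
  assumes "0 < s"
  shows "has_bochner_integral (normal_law \<mu> s) (\<lambda>z. (p + q * z)\<^sup>2) ((p + q * \<mu>)\<^sup>2 + q\<^sup>2 * s\<^sup>2)"
proof -
  have "has_bochner_integral (normal_law \<mu> s) (\<lambda>z. ((p + q * \<mu>) + q * (z - \<mu>))\<^sup>2)
      ((p + q * \<mu>)\<^sup>2 + q\<^sup>2 * s\<^sup>2)"
    using has_bochner_integral_square_affine normal_law_moments prob_space_normal_density assms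
    by blast
  then show ?thesis by (simp add: algebra_simps)
qed

context
  fixes \<tau> :: real
  assumes \<tau>: "0 < \<tau>"
begin

lemma prob_space_gaussian: "prob_space (gaussian \<tau>)"
  using \<tau> by (simp add: gaussian_eq_normal_law prob_space_normal_density)

lemma gaussian_moments:
  "has_bochner_integral (gaussian \<tau>) (\<lambda>z. z) 0"
  "has_bochner_integral (gaussian \<tau>) (\<lambda>z. z\<^sup>2) (1 / \<tau>)"
  using normal_law_moments[of "1 / sqrt \<tau>" 0] \<tau>
  by (simp_all add: gaussian_eq_normal_law power_divide)

lemma prob_space_private_noise: "prob_space (private_noise \<tau> :: ('n::finite \<Rightarrow> real) measure)"
  unfolding private_noise_def by (intro prob_space_PiM prob_space_gaussian)

text \<open>The marginal of a product of probability measures is the factor, so integrals transfer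
  along the projection.\<close>

lemma has_bochner_integral_private_noise_component:
  fixes f :: "real \<Rightarrow> real" and j :: "'n::finite"
  assumes "has_bochner_integral (gaussian \<tau>) f v"
  shows "has_bochner_integral (private_noise \<tau>) (\<lambda>\<epsilon>. f (\<epsilon> j)) v"
proof -
  have *: "distr (private_noise \<tau>) (gaussian \<tau>) (\<lambda>\<epsilon>. \<epsilon> j) = gaussian \<tau>"
    unfolding private_noise_def by (rule distr_PiM_component) (auto intro: prob_space_gaussian)
  have m: "(\<lambda>\<epsilon>. \<epsilon> j) \<in> measurable (private_noise \<tau>) (gaussian \<tau>)"
    unfolding private_noise_def by (rule measurable_component_singleton) simp
  have f: "f \<in> borel_measurable (gaussian \<tau>)"
    using assms by (rule borel_measurable_has_bochner_integral)
  have fi: "integrable (gaussian \<tau>) f" "integral\<^sup>L (gaussian \<tau>) f = v"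
    using assms by (simp_all add: has_bochner_integral_iff)
  have "integrable (private_noise \<tau>) (\<lambda>\<epsilon>. f (\<epsilon> j))"
    using iffD1[OF integrable_distr_eq[OF m f]] fi(1) * by simp
  moreover have "integral\<^sup>L (private_noise \<tau>) (\<lambda>\<epsilon>. f (\<epsilon> j)) = v"
    using integral_distr[OF m f] fi(2) * by simp
  ultimately show ?thesis
    by (simp add: has_bochner_integral_iff)
qed

lemmas private_noise_moments =
  has_bochner_integral_private_noise_component[OF gaussian_moments(1)]
  has_bochner_integral_private_noise_component[OF gaussian_moments(2)]

lemma private_noise_uncorrelated:
  fixes j k :: "'n::finite"
  assumes "j \<noteq> k"
  shows "has_bochner_integral (private_noise \<tau>) (\<lambda>\<epsilon>. \<epsilon> j * \<epsilon> k) 0"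
proof -
  interpret prob_space "gaussian \<tau>" by (rule prob_space_gaussian)
  interpret product_sigma_finite "\<lambda>_::'n. gaussian \<tau>" by unfold_locales
  \<comment> \<open>Padding with the factor 1 at the other coordinates turns
    \<open>\<epsilon> j * \<epsilon> k\<close> into a product over all agents, whose integral
    factorises; the factor at \<open>j\<close> has mean zero.\<close>
  define f :: "'n \<Rightarrow> real \<Rightarrow> real" where "f l = (if l = j \<or> l = k then \<lambda>z. z else (\<lambda>_. 1))" for l
  have f: "integrable (gaussian \<tau>) (f l)" for l
    using gaussian_moments(1) by (auto simp: f_def has_bochner_integral_iff)
  have "(\<Prod>l\<in>UNIV. f l (\<epsilon> l)) = (\<Prod>l\<in>{j, k}. f l (\<epsilon> l))" for \<epsilon>
    by (rule prod.mono_neutral_right) (auto simp: f_def)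
  then have *: "(\<Prod>l\<in>UNIV. f l (\<epsilon> l)) = \<epsilon> j * \<epsilon> k" for \<epsilon>
    using assms by (simp add: f_def)
  have "(\<Prod>l\<in>UNIV. integral\<^sup>L (gaussian \<tau>) (f l)) = 0"
    using gaussian_moments(1) by (auto simp: f_def has_bochner_integral_iff intro!: exI[of _ j])
  then show ?thesis
    using product_integrable_prod[of UNIV f, OF _ f] product_integral_prod[of UNIV f, OF _ f]
    by (simp add: * has_bochner_integral_iff private_noise_def)
qed

end

text \<open>Fubini for independent factors. With one factor constantly 1 it also lifts moments of a
  single component to the joint noise space.\<close>

lemma has_bochner_integral_pair_mult:
  fixes f :: "'a \<Rightarrow> real" and g :: "'b \<Rightarrow> real"
  assumes "prob_space M" "prob_space N"
    and f: "has_bochner_integral M f v" and g: "has_bochner_integral N g w"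
  shows "has_bochner_integral (M \<Otimes>\<^sub>M N) (\<lambda>\<omega>. f (fst \<omega>) * g (snd \<omega>)) (v * w)"
proof -
  interpret M: prob_space M by fact
  interpret N: prob_space N by fact
  interpret pair_sigma_finite M N by unfold_locales
  have [measurable]: "f \<in> borel_measurable M" "g \<in> borel_measurable N"
    and fi: "integrable M f" "integral\<^sup>L M f = v" and gi: "integrable N g" "integral\<^sup>L N g = w"
    using f g by (auto simp: has_bochner_integral_iff)
  have i: "integrable (M \<Otimes>\<^sub>M N) (\<lambda>\<omega>. f (fst \<omega>) * g (snd \<omega>))"
    by (rule Fubini_integrable) (use fi gi in \<open>auto simp: abs_mult\<close>)
  then show ?thesis
    using integral_fst'[OF i] fi gi by (simp add: has_bochner_integral_iff)
qed

section \<open>Posteriors and best responses\<close>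

lemma normal_density_precision:
  "0 < \<tau> \<Longrightarrow> normal_density m (1 / sqrt \<tau>) z = sqrt (\<tau> / (2 * pi)) * exp (- \<tau> * (z - m)\<^sup>2 / 2)"
  by (simp add: normal_density_def power_divide real_sqrt_divide real_sqrt_mult)

text \<open>A normal density has mass one, so normalising cancels the constant \<open>K\<close>; the
  likelihood matters only up to a factor free of the state.\<close>

lemma posterior_eq_normal_law:
  assumes "0 < s" and "0 < K" and "\<And>\<theta>. L \<theta> = K * normal_density m s \<theta>"
  shows "posterior L = normal_law m s"
  using assms by (simp add: posterior_def)

text \<open>The normal density is symmetric in signal and state, so under the flat prior the
  likelihood already is the posterior density.\<close>

lemma posterior_private:
  assumes "0 < \<tau>x"
  shows "posterior (private_likelihood \<tau>x x) = normal_law x (1 / sqrt \<tau>x)"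
  by (rule posterior_eq_normal_law[where K = 1])
    (use assms in \<open>auto simp: private_likelihood_def normal_density_precision power2_commute\<close>)

text \<open>Completing the square in the state: precisions add, and the mean weights the two signals
  by their precisions.\<close>

lemma posterior_joint:
  assumes \<tau>: "0 < \<tau>x" "0 < \<tau>y" and \<gamma>: "\<gamma> = \<tau>x / (\<tau>x + \<tau>y)"
  shows "posterior (joint_likelihood \<tau>x \<tau>y x y) =
    normal_law (\<gamma> * x + (1 - \<gamma>) * y) (1 / sqrt (\<tau>x + \<tau>y))"
proof (rule posterior_eq_normal_law)
  define N where "N = sqrt ((\<tau>x + \<tau>y) / (2 * pi))"
  have "0 < N" using \<tau> by (simp add: N_def)
  \<comment> \<open>\<open>K\<close> collects what does not depend on the state: the ratio of the
    normalising constants and the remainder in \<open>x - y\<close> left by completing the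
    square.\<close>
  define K where "K = sqrt (\<tau>x / (2 * pi)) * sqrt (\<tau>y / (2 * pi)) / N
    * exp (- (\<tau>x * \<tau>y / (\<tau>x + \<tau>y)) * (x - y)\<^sup>2 / 2)"
  show "0 < K" using \<tau> \<open>0 < N\<close> by (simp add: K_def)
  fix \<theta>
  have "\<tau>x * (x - \<theta>)\<^sup>2 + \<tau>y * (y - \<theta>)\<^sup>2 =
      \<tau>x * \<tau>y / (\<tau>x + \<tau>y) * (x - y)\<^sup>2 + (\<tau>x + \<tau>y) * (\<theta> - (\<gamma> * x + (1 - \<gamma>) * y))\<^sup>2"
  proof -
    \<comment> \<open>Naming the sum leaves a single atomic denominator to clear.\<close>
    define S where "S = \<tau>x + \<tau>y"
    have "S \<noteq> 0" using \<tau> by (simp add: S_def)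
    have y: "\<tau>y = S - \<tau>x" by (simp add: S_def)
    show ?thesis
      unfolding \<gamma> S_def[symmetric] unfolding y using \<open>S \<noteq> 0\<close>
      by (simp add: field_simps power2_eq_square)
  qed
  \<comment> \<open>Stated for generic terms so that the identity is carried to the exponents
    without expanding the squares.\<close>
  moreover have "- a * u / 2 + - b * v / 2 = - c * w / 2 + - d * z / 2"
    if "a * u + b * v = c * w + d * z" for a b c d u v w z :: real
    using that by simp
  ultimately have e: "exp (- \<tau>x * (x - \<theta>)\<^sup>2 / 2) * exp (- \<tau>y * (y - \<theta>)\<^sup>2 / 2) =
      exp (- (\<tau>x * \<tau>y / (\<tau>x + \<tau>y)) * (x - y)\<^sup>2 / 2)
      * exp (- (\<tau>x + \<tau>y) * (\<theta> - (\<gamma> * x + (1 - \<gamma>) * y))\<^sup>2 / 2)"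
    unfolding exp_add[symmetric] by blast
  have "joint_likelihood \<tau>x \<tau>y x y \<theta> = sqrt (\<tau>x / (2 * pi)) * sqrt (\<tau>y / (2 * pi))
      * (exp (- \<tau>x * (x - \<theta>)\<^sup>2 / 2) * exp (- \<tau>y * (y - \<theta>)\<^sup>2 / 2))"
    using \<tau> by (simp add: joint_likelihood_def normal_density_precision)
  also have "\<dots> = K * (N * exp (- (\<tau>x + \<tau>y) * (\<theta> - (\<gamma> * x + (1 - \<gamma>) * y))\<^sup>2 / 2))"
    using \<open>0 < N\<close> unfolding e K_def by simp
  also have "\<dots> = K * normal_density (\<gamma> * x + (1 - \<gamma>) * y) (1 / sqrt (\<tau>x + \<tau>y)) \<theta>"
    using \<tau> by (subst normal_density_precision) (simp_all only: N_def add_pos_pos)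
  finally show "joint_likelihood \<tau>x \<tau>y x y \<theta> =
      K * normal_density (\<gamma> * x + (1 - \<gamma>) * y) (1 / sqrt (\<tau>x + \<tau>y)) \<theta>" .
qed (use \<tau> in simp)

text \<open>The weights sum to one. The argument \<open>m\<close> is meant as the posterior mean of
  the state and \<open>a j\<close> as the expected action of opponent \<open>j\<close>.\<close>

definition best_response :: "real ^ 'n ^ 'n \<Rightarrow> 'n::finite \<Rightarrow> ('n \<Rightarrow> real) \<Rightarrow> real \<Rightarrow> real" where
  "best_response G i a m = (1 - out_degree G i) * m + (\<Sum>j\<in>UNIV - {i}. G $ i $ j * a j)"

text \<open>The payoff is quadratic in \<open>t\<close> with leading coefficient -1, since the
  weights \<open>1 - out_degree G i\<close> and \<open>G $ i $ j\<close> sum to one. Signal noise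
  and posterior uncertainty only add variances free of \<open>t\<close>.\<close>

lemma interim_payoff_affine:
  fixes G :: "real ^ 'n::finite ^ 'n"
  assumes "0 < \<tau>x" and "0 < s" and L: "posterior L = normal_law m s"
  shows "\<exists>C. \<forall>t. interim_payoff \<tau>x G L i (\<lambda>j x. \<beta> j * x + k j) t
    = C - (t - best_response G i (\<lambda>j. \<beta> j * m + k j) m)\<^sup>2"
proof -
  let ?N = "UNIV - {i}" and ?d = "out_degree G i"
  define b where "b = best_response G i (\<lambda>j. \<beta> j * m + k j) m"
  \<comment> \<open>The value at the optimum: \<open>b\<^sup>2\<close> completes the square, the
    rest is the payoff at \<open>t = 0\<close>. Opponent \<open>j\<close> contributes variance from
    the state, \<open>(\<beta> j)\<^sup>2 * s\<^sup>2\<close>, and from her own noise.\<close>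
  define C where "C = b\<^sup>2 - (1 - ?d) * (m\<^sup>2 + s\<^sup>2)
    - (\<Sum>j\<in>?N. G $ i $ j * ((\<beta> j * m + k j)\<^sup>2 + (\<beta> j)\<^sup>2 * s\<^sup>2 + (\<beta> j)\<^sup>2 * (1 / \<tau>x)))"
  have noise: "prob_space (private_noise \<tau>x :: ('n \<Rightarrow> real) measure)"
    using assms by (rule_tac prob_space_private_noise)
  interpret N: prob_space "private_noise \<tau>x :: ('n \<Rightarrow> real) measure" by (rule noise)
  have posterior: "prob_space (normal_law m s)"
    using assms by (simp add: prob_space_normal_density)
  interpret P: prob_space "normal_law m s" by (rule posterior)
  have "interim_payoff \<tau>x G L i (\<lambda>j x. \<beta> j * x + k j) t = C - (t - b)\<^sup>2" for t
  proof -
    \<comment> \<open>Inner integral at a fixed state: only the noise of the opponents is averaged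
      out.\<close>
    have "has_bochner_integral (private_noise \<tau>x)
        (\<lambda>\<epsilon>. payoff G i (\<lambda>j. if j = i then t else \<beta> j * (\<theta> + \<epsilon> j) + k j) \<theta>)
        (- (1 - ?d) * (t - \<theta>)\<^sup>2
          - (\<Sum>j\<in>?N. G $ i $ j * ((t - k j - \<beta> j * \<theta>)\<^sup>2 + (\<beta> j)\<^sup>2 * (1 / \<tau>x))))" for \<theta>
    proof -
      have "has_bochner_integral (private_noise \<tau>x)
          (\<lambda>\<epsilon>. - (1 - ?d) * (t - \<theta>)\<^sup>2
            - (\<Sum>j\<in>?N. G $ i $ j * ((t - k j - \<beta> j * \<theta>) + (- \<beta> j) * \<epsilon> j)\<^sup>2))
          (- (1 - ?d) * (t - \<theta>)\<^sup>2
            - (\<Sum>j\<in>?N. G $ i $ j * ((t - k j - \<beta> j * \<theta>)\<^sup>2 + (- \<beta> j)\<^sup>2 * (1 / \<tau>x))))"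
        by (intro has_bochner_integral_diff has_bochner_integral_sum has_bochner_integral_mult_right
            has_bochner_integral_square_affine noise private_noise_moments assms)
          (simp add: has_bochner_integral_iff N.prob_space)
      moreover have "payoff G i (\<lambda>j. if j = i then t else \<beta> j * (\<theta> + \<epsilon> j) + k j) \<theta> =
          - (1 - ?d) * (t - \<theta>)\<^sup>2
            - (\<Sum>j\<in>?N. G $ i $ j * ((t - k j - \<beta> j * \<theta>) + (- \<beta> j) * \<epsilon> j)\<^sup>2)" for \<epsilon>
        unfolding payoff_def out_degree_def
        by (auto intro!: sum.cong simp: algebra_simps)
      ultimately show ?thesis by simp
    qed
    note inner = has_bochner_integral_integral_eq[OF this]
    \<comment> \<open>Outer integral: each squared term is affine in the state, so it yields its
      value at \<open>m\<close> plus a multiple of \<open>s\<^sup>2\<close>.\<close>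
    have "has_bochner_integral (normal_law m s)
        (\<lambda>\<theta>. - (1 - ?d) * (t + (- 1) * \<theta>)\<^sup>2
          - (\<Sum>j\<in>?N. G $ i $ j * ((t - k j + (- \<beta> j) * \<theta>)\<^sup>2 + (\<beta> j)\<^sup>2 * (1 / \<tau>x))))
        (- (1 - ?d) * ((t + (- 1) * m)\<^sup>2 + (- 1)\<^sup>2 * s\<^sup>2)
          - (\<Sum>j\<in>?N. G $ i $ j * (((t - k j + (- \<beta> j) * m)\<^sup>2 + (- \<beta> j)\<^sup>2 * s\<^sup>2)
              + (\<beta> j)\<^sup>2 * (1 / \<tau>x))))"
      by (intro has_bochner_integral_diff has_bochner_integral_sum has_bochner_integral_mult_right
          has_bochner_integral_add normal_law_square_affine assms)
        (simp add: has_bochner_integral_iff P.prob_space[simplified])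
    then have "interim_payoff \<tau>x G L i (\<lambda>j x. \<beta> j * x + k j) t =
        - (1 - ?d) * ((t - m)\<^sup>2 + s\<^sup>2)
          - (\<Sum>j\<in>?N. G $ i $ j * ((t - (\<beta> j * m + k j))\<^sup>2 + (\<beta> j)\<^sup>2 * s\<^sup>2 + (\<beta> j)\<^sup>2 * (1 / \<tau>x)))"
      unfolding interim_payoff_def L inner
      by (auto dest!: has_bochner_integral_integral_eq simp: algebra_simps)
    also have "\<dots> = C - (t - b)\<^sup>2"
    proof -
      \<comment> \<open>Sorting by powers of \<open>t\<close>: the linear coefficient contains the
        opponents' share of \<open>b\<close>, that is \<open>b - (1 - ?d) * m\<close>.\<close>
      have "(\<Sum>j\<in>?N. G $ i $ j * ((t - (\<beta> j * m + k j))\<^sup>2 + (\<beta> j)\<^sup>2 * s\<^sup>2 + (\<beta> j)\<^sup>2 * (1 / \<tau>x))) =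
        (\<Sum>j\<in>?N. G $ i $ j * t\<^sup>2 - 2 * t * (G $ i $ j * (\<beta> j * m + k j))
          + G $ i $ j * ((\<beta> j * m + k j)\<^sup>2 + (\<beta> j)\<^sup>2 * s\<^sup>2 + (\<beta> j)\<^sup>2 * (1 / \<tau>x)))"
        by (intro sum.cong refl) (simp add: power2_eq_square algebra_simps)
      also have "\<dots> = ?d * t\<^sup>2 - 2 * t * (b - (1 - ?d) * m)
          + (\<Sum>j\<in>?N. G $ i $ j * ((\<beta> j * m + k j)\<^sup>2 + (\<beta> j)\<^sup>2 * s\<^sup>2 + (\<beta> j)\<^sup>2 * (1 / \<tau>x)))"
        unfolding sum.distrib sum_subtractf sum_distrib_left[symmetric] sum_distrib_right[symmetric]
        by (simp add: b_def best_response_def out_degree_def)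
      finally show ?thesis
        unfolding C_def by (simp add: power2_eq_square algebra_simps)
    qed
    finally show ?thesis .
  qed
  then show ?thesis unfolding b_def by blast
qed

lemma interim_optimal_iff:
  fixes G :: "real ^ 'n::finite ^ 'n"
  assumes "0 < \<tau>x" and "0 < s" and "posterior L = normal_law m s"
  shows "(\<forall>t. interim_payoff \<tau>x G L i (\<lambda>j x. \<beta> j * x + k j) t
      \<le> interim_payoff \<tau>x G L i (\<lambda>j x. \<beta> j * x + k j) a)
    \<longleftrightarrow> a = best_response G i (\<lambda>j. \<beta> j * m + k j) m"
proof -
  let ?b = "best_response G i (\<lambda>j. \<beta> j * m + k j) m"
  obtain C where "\<And>t. interim_payoff \<tau>x G L i (\<lambda>j x. \<beta> j * x + k j) t = C - (t - ?b)\<^sup>2"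
    using interim_payoff_affine[OF assms] by blast
  moreover have "(\<forall>t. C - (t - ?b)\<^sup>2 \<le> C - (a - ?b)\<^sup>2) \<longleftrightarrow> a = ?b"
    \<comment> \<open>Testing the deviation to \<open>?b\<close> itself forces
      \<open>(a - ?b)\<^sup>2 \<le> 0\<close>.\<close>
    by (auto dest: spec[of _ ?b])
  ultimately show ?thesis by simp
qed

section \<open>Equilibrium\<close>

text \<open>The diagonal of \<open>G\<close> vanishes, so sums over neighbours become rows of a
  matrix-vector product.\<close>

lemma sum_neighbours:
  assumes "interaction_network G"
  shows "(\<Sum>j\<in>UNIV - {i}. G $ i $ j * f j) = (\<Sum>j\<in>UNIV. G $ i $ j * f j)"
  using assms by (intro sum.mono_neutral_left) (auto simp: interaction_network_def)

text \<open>At an index where \<open>\<bar>v\<bar>\<close> is maximal, row sums below one leave no room for a nonzero value.\<close>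

lemma network_fixpoint_zero:
  fixes G :: "real ^ 'n::finite ^ 'n"
  assumes G: "interaction_network G" and r: "0 \<le> r" "r \<le> 1"
    and v: "\<And>i. v i = r * (\<Sum>j\<in>UNIV. G $ i $ j * v j)"
  shows "v i = 0"
proof -
  define M where "M = Max (range (\<lambda>j. \<bar>v j\<bar>))"
  have le: "\<bar>v j\<bar> \<le> M" for j unfolding M_def by simp
  have "M \<in> range (\<lambda>j. \<bar>v j\<bar>)" unfolding M_def by (rule Max_in) auto
  then obtain k where k: "M = \<bar>v k\<bar>" by auto
  have "\<bar>\<Sum>j\<in>UNIV. G $ k $ j * v j\<bar> \<le> (\<Sum>j\<in>UNIV. G $ k $ j * M)"
    using G le by (intro order_trans[OF sum_abs] sum_mono)
      (auto simp: abs_mult interaction_network_def intro!: mult_left_mono)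
  also have "\<dots> = out_degree G k * M"
    unfolding out_degree_def sum_distrib_right sum_neighbours[OF G] ..
  finally have "M \<le> r * (out_degree G k * M)"
    using r v[of k] by (simp add: k abs_mult mult_left_mono)
  also have "\<dots> \<le> out_degree G k * M"
  proof -
    have "0 \<le> out_degree G k * M"
      using G unfolding k out_degree_def interaction_network_def
      by (intro mult_nonneg_nonneg sum_nonneg) auto
    then show ?thesis using mult_right_mono[OF r(2)] by fastforce
  qed
  finally have "(1 - out_degree G k) * M \<le> 0" by (simp add: algebra_simps)
  then have "M \<le> 0"
    using G by (simp add: mult_le_0_iff interaction_network_def) (metis not_le)
  then show ?thesis using le[of i] by simp
qed

text \<open>A kernel vector of \<open>mat 1 - \<gamma> *\<^sub>R G\<close> is a homogeneous fixed
  point, hence zero. The matrix is therefore invertible, and the claim is a coordinate of the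
  defining linear system.\<close>

lemma katz_bonacich_fixpoint:
  fixes G :: "real ^ 'n::finite ^ 'n"
  assumes "interaction_network G" and "0 \<le> \<gamma>" "\<gamma> \<le> 1"
  shows "katz_bonacich \<gamma> G $ i = 1 + \<gamma> * (\<Sum>j\<in>UNIV. G $ i $ j * katz_bonacich \<gamma> G $ j)"
proof -
  let ?A = "mat 1 - \<gamma> *\<^sub>R G"
  have A: "(?A *v x) $ l = x $ l - \<gamma> * (\<Sum>j\<in>UNIV. G $ l $ j * x $ j)" for x l
    unfolding matrix_vector_mult_diff_rdistrib scaleR_matrix_vector_assoc[symmetric]
    by (simp add: matrix_vector_mul_lid) (simp add: matrix_vector_mult_def)
  have "x = 0" if "?A *v x = 0" for x
  proof -
    have "x $ l = \<gamma> * (\<Sum>j\<in>UNIV. G $ l $ j * x $ j)" for l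
      using A[of x l] that by simp
    from network_fixpoint_zero[OF assms this] show ?thesis by (simp add: vec_eq_iff)
  qed
  then have "invertible ?A"
    by (simp add: invertible_left_inverse matrix_left_invertible_ker)
  \<comment> \<open>\<open>matrix_inv\<close> is a choice operator; invertibility supplies the
    witness that makes the choice an actual inverse.\<close>
  then have "?A ** matrix_inv ?A = mat 1"
    unfolding invertible_def matrix_inv_def by (rule someI2_ex) simp
  then have "?A *v katz_bonacich \<gamma> G = (\<chi> i. 1)"
    by (simp add: katz_bonacich_def matrix_vector_mul_assoc)
  then show ?thesis using A[of "katz_bonacich \<gamma> G" i] by simp
qed


text \<open>Measuring actions relative to \<open>m\<close> absorbs the weight on the state, which
  prepares the equilibrium conditions for the fixed-point lemmas.\<close>

lemma best_response_UNIV: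
  assumes "interaction_network G"
  shows "best_response G i a m = m + (\<Sum>j\<in>UNIV. G $ i $ j * (a j - m))"
  unfolding best_response_def out_degree_def sum_neighbours[OF assms]
    sum_neighbours[OF assms, of _ "\<lambda>_. 1", simplified]
  by (simp add: right_diff_distrib sum_subtractf sum_distrib_right[symmetric] left_diff_distrib)

text \<open>The difference of two solutions solves the homogeneous equation.\<close>

lemma network_fixpoint_unique:
  fixes G :: "real ^ 'n::finite ^ 'n"
  assumes "interaction_network G" and "0 \<le> r" "r \<le> 1"
    and "\<And>i. v i = b i + r * (\<Sum>j\<in>UNIV. G $ i $ j * v j)"
    and "\<And>i. w i = b i + r * (\<Sum>j\<in>UNIV. G $ i $ j * w j)"
  shows "v i = w i"
proof -
  have "v i - w i = r * (\<Sum>j\<in>UNIV. G $ i $ j * (v j - w j))" for i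
    using assms(4)[of i] assms(5)[of i]
    by (simp add: right_diff_distrib sum_subtractf)
  from network_fixpoint_zero[OF assms(1-3), where v = "\<lambda>i. v i - w i", OF this]
  show ?thesis by simp
qed

section \<open>Form and uniqueness of linear equilibria\<close>

text \<open>The posterior mean is the signal \<open>x\<close> itself, so at each \<open>x\<close>
  the deviations \<open>\<sigma> i x - x\<close> form a homogeneous fixed point of \<open>G\<close>
  and vanish.\<close>

lemma linear_BNE_private_iff:
  fixes G :: "real ^ 'n::finite ^ 'n"
  assumes G: "interaction_network G" and \<tau>: "0 < \<tau>x"
  shows "linear_BNE_private \<tau>x G \<sigma> \<longleftrightarrow> \<sigma> = (\<lambda>_ x. x)"
proof -
  have optimal: "(\<forall>i x t. interim_payoff \<tau>x G (private_likelihood \<tau>x x) i \<sigma> t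
        \<le> interim_payoff \<tau>x G (private_likelihood \<tau>x x) i \<sigma> (\<sigma> i x))
      \<longleftrightarrow> (\<forall>i x. \<beta> i * x + \<kappa> i = x + (\<Sum>j\<in>UNIV. G $ i $ j * (\<beta> j * x + \<kappa> j - x)))"
    if "\<sigma> = (\<lambda>i x. \<beta> i * x + \<kappa> i)" for \<beta> \<kappa>
    unfolding that best_response_UNIV[OF G, symmetric]
    using interim_optimal_iff[OF \<tau> _ posterior_private[OF \<tau>], where \<beta> = \<beta> and k = \<kappa>] \<tau> by simp
  show ?thesis
  proof
    assume eq: "linear_BNE_private \<tau>x G \<sigma>"
    then have "\<forall>i. \<exists>\<beta> \<kappa>. \<forall>x. \<sigma> i x = \<beta> * x + \<kappa>" by (simp add: linear_BNE_private_def)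
    then obtain \<beta> \<kappa> where \<sigma>: "\<sigma> = (\<lambda>i x. \<beta> i * x + \<kappa> i)" by metis
    have br: "\<beta> i * x + \<kappa> i = x + (\<Sum>j\<in>UNIV. G $ i $ j * (\<beta> j * x + \<kappa> j - x))" for i x
      using eq optimal[OF \<sigma>] unfolding linear_BNE_private_def by blast
    have "\<beta> i * x + \<kappa> i - x = 0" for i x
    proof (rule network_fixpoint_zero[OF G, of 1])
      show "\<beta> i * x + \<kappa> i - x = 1 * (\<Sum>j\<in>UNIV. G $ i $ j * (\<beta> j * x + \<kappa> j - x))" for i
        using br[of i x] by linarith
    qed simp_all
    then show "\<sigma> = (\<lambda>_ x. x)" by (simp add: \<sigma>)
  next
    assume \<sigma>: "\<sigma> = (\<lambda>_ x. x)"
    have "\<exists>\<beta> \<kappa>. \<forall>x. x = \<beta> * x + (\<kappa>::real)" by (intro exI[of _ 1] exI[of _ 0]) simp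
    then show "linear_BNE_private \<tau>x G \<sigma>"
      unfolding linear_BNE_private_def using optimal[of "\<lambda>_. 1" "\<lambda>_. 0"] by (simp add: \<sigma>)
  qed
qed

text \<open>Evaluating the best-response identity at three signal pairs determines all coefficients;
  conversely, the resulting profile satisfies the identity at every pair.\<close>

lemma linear_BNE_iff:
  fixes G :: "real ^ 'n::finite ^ 'n"
  assumes G: "interaction_network G" and \<tau>: "0 < \<tau>x" "0 < \<tau>y"
    and \<gamma>: "\<gamma> = \<tau>x / (\<tau>x + \<tau>y)"
  shows "linear_BNE \<tau>x \<tau>y G \<sigma> \<longleftrightarrow>
    \<sigma> = (\<lambda>i x y. (1 - \<gamma>) * katz_bonacich \<gamma> G $ i * y + (1 - (1 - \<gamma>) * katz_bonacich \<gamma> G $ i) * x)"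
proof -
  define A where "A i = (1 - \<gamma>) * katz_bonacich \<gamma> G $ i" for i
  have \<gamma>01: "0 \<le> \<gamma>" "\<gamma> \<le> 1" using \<tau> by (auto simp: \<gamma>)
  \<comment> \<open>The Katz-Bonacich equation scaled by \<open>1 - \<gamma>\<close>; the weights on
    the public signal will satisfy the same equation.\<close>
  have A: "A i = (1 - \<gamma>) + \<gamma> * (\<Sum>j\<in>UNIV. G $ i $ j * A j)" for i
    unfolding A_def using katz_bonacich_fixpoint[OF G \<gamma>01, of i]
    by (simp add: sum_distrib_left algebra_simps)
  define \<mu> where "\<mu> x y = \<gamma> * x + (1 - \<gamma>) * y" for x y
  have optimal: "(\<forall>i x y t. interim_payoff \<tau>x G (joint_likelihood \<tau>x \<tau>y x y) i (\<lambda>j x'. \<sigma> j x' y) t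
        \<le> interim_payoff \<tau>x G (joint_likelihood \<tau>x \<tau>y x y) i (\<lambda>j x'. \<sigma> j x' y) (\<sigma> i x y))
      \<longleftrightarrow> (\<forall>i x y. \<alpha> i * y + \<beta> i * x + \<kappa> i =
        \<mu> x y + (\<Sum>j\<in>UNIV. G $ i $ j * (\<beta> j * \<mu> x y + (\<alpha> j * y + \<kappa> j) - \<mu> x y)))"
    if \<sigma>: "\<sigma> = (\<lambda>i x y. \<alpha> i * y + \<beta> i * x + \<kappa> i)" for \<alpha> \<beta> \<kappa>
  proof -
    have "(\<lambda>j x'. \<sigma> j x' y) = (\<lambda>j x'. \<beta> j * x' + (\<alpha> j * y + \<kappa> j))" for y
      by (simp add: \<sigma> fun_eq_iff)
    then show ?thesis
      unfolding best_response_UNIV[OF G, symmetric]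
      using interim_optimal_iff[OF \<tau>(1) _ posterior_joint[OF \<tau> \<gamma>], where \<beta> = \<beta>] \<tau>
      by (simp add: \<mu>_def \<sigma>)
  qed
  have "linear_BNE \<tau>x \<tau>y G \<sigma> \<longleftrightarrow> \<sigma> = (\<lambda>i x y. A i * y + (1 - A i) * x)"
  proof
    assume eq: "linear_BNE \<tau>x \<tau>y G \<sigma>"
    then have "\<forall>i. \<exists>\<alpha> \<beta> \<kappa>. \<forall>x y. \<sigma> i x y = \<alpha> * y + \<beta> * x + \<kappa>" by (simp add: linear_BNE_def)
    then obtain \<alpha> \<beta> \<kappa> where \<sigma>: "\<sigma> = (\<lambda>i x y. \<alpha> i * y + \<beta> i * x + \<kappa> i)" by metis
    have br: "\<alpha> i * y + \<beta> i * x + \<kappa> i =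
        \<mu> x y + (\<Sum>j\<in>UNIV. G $ i $ j * (\<beta> j * \<mu> x y + (\<alpha> j * y + \<kappa> j) - \<mu> x y))" for i x y
      using eq optimal[OF \<sigma>] unfolding linear_BNE_def by blast
    \<comment> \<open>Signals \<open>(0, 0)\<close> isolate the intercepts, which form a homogeneous
      fixed point.\<close>
    have \<kappa>: "\<kappa> i = 0" for i
    proof (rule network_fixpoint_zero[OF G, of 1])
      show "\<kappa> i = 1 * (\<Sum>j\<in>UNIV. G $ i $ j * \<kappa> j)" for i
        using br[of i 0 0] by (simp add: \<mu>_def)
    qed simp_all
    \<comment> \<open>At signals \<open>(1, 1)\<close> the posterior mean is 1, so the total weights
      differ from 1 by a homogeneous fixed point.\<close>
    have "\<alpha> i + \<beta> i - 1 = 0" for i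
    proof (rule network_fixpoint_zero[OF G, of 1])
      show "\<alpha> i + \<beta> i - 1 = 1 * (\<Sum>j\<in>UNIV. G $ i $ j * (\<alpha> j + \<beta> j - 1))" for i
        using br[of i 1 1] \<kappa> by (simp add: \<mu>_def add.commute)
    qed simp_all
    then have \<alpha>: "\<alpha> i = 1 - \<beta> i" for i by (smt (verit))
    \<comment> \<open>At signals \<open>(1, 0)\<close> the posterior mean is
      \<open>\<gamma>\<close>, which brings in the discount factor of the centrality
      equation.\<close>
    have "1 - \<beta> i = (1 - \<gamma>) + \<gamma> * (\<Sum>j\<in>UNIV. G $ i $ j * (1 - \<beta> j))" for i
    proof -
      have "\<gamma> * (\<Sum>j\<in>UNIV. G $ i $ j * (1 - \<beta> j)) = - (\<Sum>j\<in>UNIV. G $ i $ j * (\<beta> j * \<gamma> - \<gamma>))"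
        unfolding sum_distrib_left sum_negf[symmetric]
        by (intro sum.cong refl) (simp add: algebra_simps)
      then show ?thesis
        using br[where i = i and x = 1 and y = 0] unfolding \<kappa> \<alpha> \<mu>_def by simp
    qed
    then have "1 - \<beta> i = A i" for i
      by (rule network_fixpoint_unique[OF G \<gamma>01, where b = "\<lambda>_. 1 - \<gamma>"]) (rule A)
    then have "\<beta> i = 1 - A i" for i by (smt (verit))
    then show "\<sigma> = (\<lambda>i x y. A i * y + (1 - A i) * x)"
      by (simp add: \<sigma> \<kappa> \<alpha>)
  next
    assume \<sigma>: "\<sigma> = (\<lambda>i x y. A i * y + (1 - A i) * x)"
    have "A i * y + (1 - A i) * x =
        \<mu> x y + (\<Sum>j\<in>UNIV. G $ i $ j * ((1 - A j) * \<mu> x y + A j * y - \<mu> x y))" for i x y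
    proof -
      have "(\<Sum>j\<in>UNIV. G $ i $ j * ((1 - A j) * \<mu> x y + A j * y - \<mu> x y))
          = (\<Sum>j\<in>UNIV. G $ i $ j * A j) * (y - \<mu> x y)"
        unfolding sum_distrib_right by (intro sum.cong refl) (simp add: algebra_simps)
      \<comment> \<open>Here \<open>y - \<mu> x y = \<gamma> * (y - x)\<close>, and the factor
        \<open>\<gamma>\<close> completes the sum to the one in the equation for
        \<open>A\<close>.\<close>
      also have "\<dots> = (A i - (1 - \<gamma>)) * (y - x)"
        using A[of i] unfolding \<mu>_def by algebra
      finally show ?thesis by (simp add: \<mu>_def algebra_simps)
    qed
    moreover have "\<exists>\<alpha> \<beta> \<kappa>. \<forall>x y. \<sigma> i x y = \<alpha> * y + \<beta> * x + \<kappa>" for i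
      by (intro exI[of _ "A i"] exI[of _ "1 - A i"] exI[of _ 0]) (simp add: \<sigma>)
    ultimately show "linear_BNE \<tau>x \<tau>y G \<sigma>"
      unfolding linear_BNE_def using optimal[of A "\<lambda>j. 1 - A j" "\<lambda>_. 0"] by (simp add: \<sigma>)
  qed
  then show ?thesis unfolding A_def .
qed


section \<open>Ex-ante payoffs\<close>

text \<open>With \<open>a j\<close> equal to the signal of \<open>j\<close>, the distance to the
  state has variance \<open>1 / \<tau>x\<close> and that to an opponent
  \<open>2 / \<tau>x\<close>.\<close>

lemma equilibrium_payoff_private_eq:
  fixes G :: "real ^ 'n::finite ^ 'n"
  assumes G: "interaction_network G" and \<tau>: "0 < \<tau>x"
  shows "equilibrium_payoff_private \<tau>x G \<theta> i = - ((1 + out_degree G i) / \<tau>x)"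
proof -
  let ?P = "private_noise \<tau>x :: ('n \<Rightarrow> real) measure"
  have "equilibrium_private \<tau>x G = (\<lambda>_ x. x)"
    unfolding equilibrium_private_def linear_BNE_private_iff[OF assms] by simp
  \<comment> \<open>The dummy summand \<open>0 * 0\<close> gives the squares the three-term shape of
    \<open>has_bochner_integral_square_lincomb3\<close>.\<close>
  then have "payoff G i (\<lambda>j. equilibrium_private \<tau>x G j (\<theta> + \<epsilon> j)) \<theta> =
      - (1 - out_degree G i) * (\<epsilon> i)\<^sup>2
        - (\<Sum>j\<in>UNIV - {i}. G $ i $ j * (1 * \<epsilon> i + (-1) * \<epsilon> j + 0 * 0)\<^sup>2)" for \<epsilon> :: "'n \<Rightarrow> real"
    by (simp add: payoff_def out_degree_def)
  moreover have "has_bochner_integral ?P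
      (\<lambda>\<epsilon>. - (1 - out_degree G i) * (\<epsilon> i)\<^sup>2
        - (\<Sum>j\<in>UNIV - {i}. G $ i $ j * (1 * \<epsilon> i + (-1) * \<epsilon> j + 0 * 0)\<^sup>2))
      (- (1 - out_degree G i) * (1 / \<tau>x)
        - (\<Sum>j\<in>UNIV - {i}. G $ i $ j * (1\<^sup>2 * (1 / \<tau>x) + (-1)\<^sup>2 * (1 / \<tau>x) + 0\<^sup>2 * 0)))"
    by (intro has_bochner_integral_diff has_bochner_integral_sum has_bochner_integral_mult_right
        has_bochner_integral_square_lincomb3 private_noise_moments private_noise_uncorrelated \<tau>)
      (auto simp: has_bochner_integral_zero)
  ultimately have "equilibrium_payoff_private \<tau>x G \<theta> i = - (1 - out_degree G i) * (1 / \<tau>x)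
        - (\<Sum>j\<in>UNIV - {i}. G $ i $ j * (2 / \<tau>x))"
    unfolding equilibrium_payoff_private_def by (auto dest!: has_bochner_integral_integral_eq)
  also have "\<dots> = - (1 - out_degree G i) * (1 / \<tau>x) - out_degree G i * (2 / \<tau>x)"
    unfolding sum_distrib_right[symmetric] out_degree_def ..
  also have "\<dots> = - ((1 + out_degree G i) / \<tau>x)"
    using \<tau> by (simp add: field_simps)
  finally show ?thesis .
qed

text \<open>The two signal weights of each agent sum to one, so the state cancels from every
  difference. Public noise enters \<open>a i - a j\<close> only through
  \<open>A i - A j\<close>.\<close>

lemma equilibrium_payoff_eq:
  fixes G :: "real ^ 'n::finite ^ 'n"
  assumes G: "interaction_network G" and \<tau>: "0 < \<tau>x" "0 < \<tau>y"
    and \<gamma>: "\<gamma> = \<tau>x / (\<tau>x + \<tau>y)"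
    and A: "\<And>j. A j = (1 - \<gamma>) * katz_bonacich \<gamma> G $ j"
  shows "equilibrium_payoff \<tau>x \<tau>y G \<theta> i =
    - (1 - out_degree G i) * ((A i)\<^sup>2 / \<tau>y + (1 - A i)\<^sup>2 / \<tau>x)
    - (\<Sum>j\<in>UNIV - {i}. G $ i $ j *
        ((A i - A j)\<^sup>2 / \<tau>y + (1 - A i)\<^sup>2 / \<tau>x + (1 - A j)\<^sup>2 / \<tau>x))"
proof -
  let ?M = "(private_noise \<tau>x :: ('n \<Rightarrow> real) measure) \<Otimes>\<^sub>M gaussian \<tau>y"
  let ?f = "\<lambda>\<omega>::('n \<Rightarrow> real) \<times> real.
    - (1 - out_degree G i) * (A i * snd \<omega> + (1 - A i) * fst \<omega> i + 0 * 0)\<^sup>2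
    - (\<Sum>j\<in>UNIV - {i}. G $ i $ j *
        ((A i - A j) * snd \<omega> + (1 - A i) * fst \<omega> i + (A j - 1) * fst \<omega> j)\<^sup>2)"
  interpret P: prob_space "private_noise \<tau>x :: ('n \<Rightarrow> real) measure"
    by (rule prob_space_private_noise) fact
  interpret Q: prob_space "gaussian \<tau>y"
    by (rule prob_space_gaussian) fact
  note mult = has_bochner_integral_pair_mult[OF P.prob_space_axioms Q.prob_space_axioms]
  have P1: "has_bochner_integral (private_noise \<tau>x :: ('n \<Rightarrow> real) measure) (\<lambda>_. 1::real) 1"
    and Q1: "has_bochner_integral (gaussian \<tau>y) (\<lambda>_. 1::real) 1"
    by (simp_all only: has_bochner_integral_iff P.integrable_const Q.integrable_const
        lebesgue_integral_const P.prob_space Q.prob_space) simp_all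
  have moments: "has_bochner_integral ?M (\<lambda>\<omega>. (snd \<omega>)\<^sup>2) (1 / \<tau>y)"
    "has_bochner_integral ?M (\<lambda>\<omega>. (fst \<omega> j)\<^sup>2) (1 / \<tau>x)"
    "has_bochner_integral ?M (\<lambda>\<omega>. snd \<omega> * fst \<omega> j) 0"
    "j \<noteq> k \<Longrightarrow> has_bochner_integral ?M (\<lambda>\<omega>. fst \<omega> j * fst \<omega> k) 0" for j k
    using mult[OF P1 gaussian_moments(2)[OF \<tau>(2)]]
      mult[OF private_noise_moments(2)[OF \<tau>(1)] Q1, of j]
      mult[OF private_noise_moments(1)[OF \<tau>(1)] gaussian_moments(1)[OF \<tau>(2)], of j]
      mult[OF private_noise_uncorrelated[OF \<tau>(1)] Q1, of j k]
    by (simp_all add: mult.commute)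
  have "equilibrium \<tau>x \<tau>y G = (\<lambda>i x y. A i * y + (1 - A i) * x)"
    unfolding equilibrium_def linear_BNE_iff[OF G \<tau> \<gamma>] A by simp
  moreover have "payoff G i (\<lambda>j. A j * (\<theta> + snd \<omega>) + (1 - A j) * (\<theta> + fst \<omega> j)) \<theta> = ?f \<omega>" for \<omega>
  proof -
    have "A j * (\<theta> + snd \<omega>) + (1 - A j) * (\<theta> + fst \<omega> j) - \<theta> = A j * snd \<omega> + (1 - A j) * fst \<omega> j + 0 * 0"
      for j by (simp add: algebra_simps)
    moreover have "A i * (\<theta> + snd \<omega>) + (1 - A i) * (\<theta> + fst \<omega> i)
        - (A j * (\<theta> + snd \<omega>) + (1 - A j) * (\<theta> + fst \<omega> j))
        = (A i - A j) * snd \<omega> + (1 - A i) * fst \<omega> i + (A j - 1) * fst \<omega> j" for j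
      by (simp add: algebra_simps)
    ultimately show ?thesis by (simp only: payoff_def out_degree_def)
  qed
  ultimately have "(\<lambda>(\<epsilon>, \<epsilon>y). payoff G i (\<lambda>j. equilibrium \<tau>x \<tau>y G j (\<theta> + \<epsilon> j) (\<theta> + \<epsilon>y)) \<theta>) = ?f"
    by (simp only: case_prod_unfold)
  moreover have "has_bochner_integral ?M ?f
      (- (1 - out_degree G i) * ((A i)\<^sup>2 * (1 / \<tau>y) + (1 - A i)\<^sup>2 * (1 / \<tau>x) + 0\<^sup>2 * 0)
      - (\<Sum>j\<in>UNIV - {i}. G $ i $ j *
        ((A i - A j)\<^sup>2 * (1 / \<tau>y) + (1 - A i)\<^sup>2 * (1 / \<tau>x) + (A j - 1)\<^sup>2 * (1 / \<tau>x))))"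
    by (intro has_bochner_integral_diff has_bochner_integral_sum has_bochner_integral_mult_right
        has_bochner_integral_square_lincomb3 moments)
      (auto simp: has_bochner_integral_zero)
  ultimately show ?thesis
    unfolding equilibrium_payoff_def
    by (auto dest!: has_bochner_integral_integral_eq simp: power2_commute)
qed

section \<open>The effect of public information\<close>

lemma public_info_effect_eq:
  fixes G :: "real ^ 'n::finite ^ 'n"
  assumes G: "interaction_network G" and \<tau>: "0 < \<tau>x" "0 < \<tau>y"
    and \<gamma>: "\<gamma> = \<tau>x / (\<tau>x + \<tau>y)" and c: "c = ($) (katz_bonacich \<gamma> G)"
  shows "public_info_effect \<tau>x \<tau>y G \<theta> i =
    (1 - \<gamma>) / \<tau>x * ((c i)\<^sup>2 - (\<Sum>j\<in>UNIV - {i}. G $ i $ j * c j * (c j - 2)))"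
proof -
  let ?N = "UNIV - {i}" and ?d = "out_degree G i"
  have \<gamma>01: "0 < \<gamma>" "\<gamma> < 1" using \<tau> by (auto simp: \<gamma>)
  define S where "S = (\<Sum>j\<in>?N. G $ i $ j * c j)"
  define Q where "Q = (\<Sum>j\<in>?N. G $ i $ j * (c j)\<^sup>2)"
  define r where "r = 1 / \<tau>x"
  define q where "q = 1 / \<tau>y"
  \<comment> \<open>Both sides are the posterior variance \<open>1 / (\<tau>x + \<tau>y)\<close>;
    this also gives \<open>(1 - \<gamma>)\<^sup>2 * (q + r) = (1 - \<gamma>) * r\<close>, the
    coefficient of \<open>Q\<close>.\<close>
  have q: "q * (1 - \<gamma>) = \<gamma> * r" unfolding q_def r_def \<gamma> using \<tau> by (simp add: field_simps)
  have S: "c i = 1 + \<gamma> * S"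
    unfolding S_def sum_neighbours[OF G] c using \<gamma>01
    by (intro katz_bonacich_fixpoint[OF G]) auto
  have "(\<Sum>j\<in>?N. G $ i $ j * (((1 - \<gamma>) * c i - (1 - \<gamma>) * c j)\<^sup>2 * q
        + (1 - (1 - \<gamma>) * c i)\<^sup>2 * r + (1 - (1 - \<gamma>) * c j)\<^sup>2 * r))
      = (\<Sum>j\<in>?N. G $ i $ j * ((1 - \<gamma>)\<^sup>2 * (c i)\<^sup>2 * q + (1 - (1 - \<gamma>) * c i)\<^sup>2 * r + r)
          - G $ i $ j * c j * (2 * (1 - \<gamma>)\<^sup>2 * c i * q + 2 * (1 - \<gamma>) * r)
          + G $ i $ j * (c j)\<^sup>2 * ((1 - \<gamma>)\<^sup>2 * (q + r)))"
    by (intro sum.cong refl) (simp add: power2_eq_square algebra_simps)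
  also have "\<dots> = ?d * ((1 - \<gamma>)\<^sup>2 * (c i)\<^sup>2 * q + (1 - (1 - \<gamma>) * c i)\<^sup>2 * r + r)
          - S * (2 * (1 - \<gamma>)\<^sup>2 * c i * q + 2 * (1 - \<gamma>) * r) + Q * ((1 - \<gamma>)\<^sup>2 * (q + r))"
    unfolding sum.distrib sum_subtractf sum_distrib_right[symmetric]
    by (simp add: S_def Q_def out_degree_def)
  finally have "public_info_effect \<tau>x \<tau>y G \<theta> i =
      - (1 - ?d) * (((1 - \<gamma>) * c i)\<^sup>2 * q + (1 - (1 - \<gamma>) * c i)\<^sup>2 * r)
      - (?d * ((1 - \<gamma>)\<^sup>2 * (c i)\<^sup>2 * q + (1 - (1 - \<gamma>) * c i)\<^sup>2 * r + r)
          - S * (2 * (1 - \<gamma>)\<^sup>2 * c i * q + 2 * (1 - \<gamma>) * r) + Q * ((1 - \<gamma>)\<^sup>2 * (q + r)))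
      + (1 + ?d) * r"
    unfolding public_info_effect_def equilibrium_payoff_private_eq[OF G \<tau>(1)]
      equilibrium_payoff_eq[OF G \<tau> \<gamma> refl]
    by (simp add: r_def q_def c)
  \<comment> \<open>The terms in \<open>?d\<close> cancel. Relation \<open>q\<close> eliminates
    \<open>q\<close>, and \<open>S\<close> replaces the cross term \<open>\<gamma> * S * c i\<close>
    by \<open>(c i - 1) * c i\<close>.\<close>
  also have "\<dots> = (1 - \<gamma>) * r * ((c i)\<^sup>2 - (Q - 2 * S))"
    using q S by algebra
  also have "Q - 2 * S = (\<Sum>j\<in>?N. G $ i $ j * c j * (c j - 2))"
    unfolding Q_def S_def
    by (simp add: sum_distrib_left sum_subtractf[symmetric] power2_eq_square algebra_simps)
  finally show ?thesis by (simp add: r_def)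
qed

theorem proposition2:
  fixes G :: "real ^ 'n::finite ^ 'n" and \<tau>x \<tau>y \<gamma> \<theta> :: real and i :: 'n
  assumes "CARD('n) \<ge> 2"
    and "interaction_network G"
    and "\<tau>x > 0" and "\<tau>y > 0"
    and "\<gamma> = \<tau>x / (\<tau>x + \<tau>y)"
  shows "public_info_effect \<tau>x \<tau>y G \<theta> i < 0 \<longleftrightarrow>
    (katz_bonacich \<gamma> G $ i)\<^sup>2 <
      (\<Sum>j\<in>UNIV - {i}. G $ i $ j * (katz_bonacich \<gamma> G $ j) * (katz_bonacich \<gamma> G $ j - 2))"
proof -
  \<comment> \<open>The prefactor \<open>(1 - \<gamma>) / \<tau>x\<close> is positive and does not
    affect the sign.\<close>
  have "k * x < 0 \<longleftrightarrow> x < 0" if "0 < k" for k x :: real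
    using that by (simp add: mult_less_0_iff)
  moreover have "0 < (1 - \<gamma>) / \<tau>x" using assms by simp
  ultimately show ?thesis
    unfolding public_info_effect_eq[OF assms(2-5) refl] by (simp only: diff_less_0_iff_less)
qed

end
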